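(* Let $a,b,c,d$ be integers with $a,b,c$ odd and $d$ even, such that both $R\left(ax+by+cz=\frac{d}{2},2\right)$ and $R(ax+by+cz=d,\mathbb{Z}/3\mathbb{Z})$ exist. Then \[2R\left(ax+by+cz=\tfrac{d}{2},2\right)\leq R(ax+by+cz=d,\mathbb{Z}/3\mathbb{Z}).\]
   Context: $[1,n]=\{1,\dots,n\}$. For an equation $\mathcal{L}$ in three variables $x,y,z$ and a coloring $\chi:[1,n]\to\{0,\dots,r-1\}$, a solution $(x_1,x_2,x_3)\in[1,n]^3$ is monochromatic if all $\chi(x_i)$ are equal, and zero-sum (for $r=3$) if $\chi(x_1)+\chi(x_2)+\chi(x_3)\equiv0\pmod 3$. $R(\mathcal{L},2)$ is the least $N$ (if it exists) such that for all $n\ge N$ every $2$-coloring of $[1,n]$ has a monochromatic solution of $\mathcal{L}$; $R(\mathcal{L},\mathbb{Z}/3\mathbb{Z})$ is the least $N$ (if it exists) such that for all $n\ge N$ every map $[1,n]\to\{0,1,2\}$ has a zero-sum solution of $\mathcal{L}$. *)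

theory Defs
  imports "HOL-Library.FuncSet" "HOL-Number_Theory.Cong"
begin

type_synonym equation3 = "nat \<Rightarrow> nat \<Rightarrow> nat \<Rightarrow> bool"

definition lin_eq :: "int \<Rightarrow> int \<Rightarrow> int \<Rightarrow> int \<Rightarrow> equation3" where
  "lin_eq a b c d x y z \<longleftrightarrow> a * int x + b * int y + c * int z = d"

definition is_coloring :: "nat \<Rightarrow> nat \<Rightarrow> (nat \<Rightarrow> nat) \<Rightarrow> bool" where
  "is_coloring r n \<chi> \<longleftrightarrow> \<chi> \<in> {1..n} \<rightarrow> {0..<r}"

definition has_mono_solution :: "equation3 \<Rightarrow> nat \<Rightarrow> (nat \<Rightarrow> nat) \<Rightarrow> bool" where
  "has_mono_solution L n \<chi> \<longleftrightarrow>
     (\<exists>x\<in>{1..n}. \<exists>y\<in>{1..n}. \<exists>z\<in>{1..n}. L x y z \<and> \<chi> x = \<chi> y \<and> \<chi> y = \<chi> z)"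

definition has_zero_sum_solution :: "equation3 \<Rightarrow> nat \<Rightarrow> (nat \<Rightarrow> nat) \<Rightarrow> bool" where
  "has_zero_sum_solution L n \<chi> \<longleftrightarrow>
     (\<exists>x\<in>{1..n}. \<exists>y\<in>{1..n}. \<exists>z\<in>{1..n}. L x y z \<and> [\<chi> x + \<chi> y + \<chi> z = 0] (mod 3))"

definition mono_bound :: "equation3 \<Rightarrow> nat \<Rightarrow> nat \<Rightarrow> bool" where
  "mono_bound L r N \<longleftrightarrow> (\<forall>n\<ge>N. \<forall>\<chi>. is_coloring r n \<chi> \<longrightarrow> has_mono_solution L n \<chi>)"

definition zero_sum_bound :: "equation3 \<Rightarrow> nat \<Rightarrow> bool" where
  "zero_sum_bound L N \<longleftrightarrow> (\<forall>n\<ge>N. \<forall>\<chi>. is_coloring 3 n \<chi> \<longrightarrow> has_zero_sum_solution L n \<chi>)"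

text \<open>
  The numbers \<open>R(L, r)\<close> and \<open>R(L, \<int>/3\<int>)\<close> are partial: the \<open>LEAST\<close> terms below are
  meaningful only under the corresponding existence predicates.
\<close>

definition mono_R_exists :: "equation3 \<Rightarrow> nat \<Rightarrow> bool" where
  "mono_R_exists L r \<longleftrightarrow> (\<exists>N. mono_bound L r N)"

definition mono_R :: "equation3 \<Rightarrow> nat \<Rightarrow> nat" where
  "mono_R L r = (LEAST N. mono_bound L r N)"

definition zero_sum_R_exists :: "equation3 \<Rightarrow> bool" where
  "zero_sum_R_exists L \<longleftrightarrow> (\<exists>N. zero_sum_bound L N)"

definition zero_sum_R :: "equation3 \<Rightarrow> nat" where
  "zero_sum_R L = (LEAST N. zero_sum_bound L N)"

end

theory Submission
  imports Defs
begin

text \<open>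
  A 2-colouring of \<open>[1,n]\<close> is lifted to a 3-colouring of \<open>[1,2n+1]\<close> by colouring an even number
  like its half and every odd number with 2. By parity a solution of \<open>ax + by + cz = d\<close> has zero
  or two odd entries. With two odd entries the colour sum is 4 or 5, never divisible by 3;
  with none, halving gives a solution of the equation for \<open>d/2\<close> whose colours, lying in
  \<open>{0,1}\<close>, sum to a multiple of 3 only if they agree.
\<close>

definition lift_coloring :: "(nat \<Rightarrow> nat) \<Rightarrow> nat \<Rightarrow> nat" where
  "lift_coloring \<chi> x = (if even x then \<chi> (x div 2) else 2)"

lemma half_mem: "even x \<Longrightarrow> x \<in> {1..2 * n + 1} \<Longrightarrow> x div 2 \<in> {1..n}" for x n :: nat
  by auto

lemma is_coloring_2_less: "is_coloring 2 n \<chi> \<Longrightarrow> x \<in> {1..n} \<Longrightarrow> \<chi> x < 2"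
  by (auto simp: is_coloring_def Pi_iff)

lemma is_coloring_lift:
  assumes "is_coloring 2 n \<chi>"
  shows "is_coloring 3 (2 * n + 1) (lift_coloring \<chi>)"
  using is_coloring_2_less[OF assms half_mem]
  by (force simp: is_coloring_def lift_coloring_def)

lemma mono_solution_of_zero_sum_lift:
  assumes "odd a" "odd b" "odd c" "even d"
    and col: "is_coloring 2 n \<chi>"
    and "has_zero_sum_solution (lin_eq a b c d) (2 * n + 1) (lift_coloring \<chi>)"
  shows "has_mono_solution (lin_eq a b c (d div 2)) n \<chi>"
proof -
  obtain x y z where mem: "x \<in> {1..2 * n + 1}" "y \<in> {1..2 * n + 1}" "z \<in> {1..2 * n + 1}"
    and eq: "a * int x + b * int y + c * int z = d"
    and sum: "3 dvd lift_coloring \<chi> x + lift_coloring \<chi> y + lift_coloring \<chi> z"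
    using assms(6) by (auto simp: has_zero_sum_solution_def lin_eq_def cong_0_iff)
  \<comment> \<open>Odd coefficients preserve parity, so \<open>d\<close> is congruent to
    \<open>x + y + z\<close> modulo 2.\<close>
  have parity: "even (x + y + z)"
    using assms(1-4) unfolding eq[symmetric] by simp
  have two: "\<chi> (w div 2) = 0 \<or> \<chi> (w div 2) = 1" if "even w" "w \<in> {1..2 * n + 1}" for w
    using is_coloring_2_less[OF col half_mem[OF that]] by linarith
  have evens: "even x" "even y" "even z"
    using parity sum two[OF _ mem(1)] two[OF _ mem(2)] two[OF _ mem(3)]
    by (auto simp: lift_coloring_def split: if_splits) presburger+
  then obtain u v w where uvw: "x = 2 * u" "y = 2 * v" "z = 2 * w"
    by (auto elim!: evenE)
  have "\<chi> u = \<chi> v" "\<chi> v = \<chi> w"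
    using sum two[OF evens(1) mem(1)] two[OF evens(2) mem(2)] two[OF evens(3) mem(3)]
    by (auto simp: lift_coloring_def uvw) presburger+
  moreover have "a * int u + b * int v + c * int w = d div 2"
    using eq by (simp add: uvw)
  moreover have "u \<in> {1..n}" "v \<in> {1..n}" "w \<in> {1..n}"
    using mem by (auto simp: uvw)
  ultimately show ?thesis
    unfolding has_mono_solution_def lin_eq_def by blast
qed

text \<open>The lift reaches \<open>2 * n + 1\<close>, not just \<open>2 * n\<close>, since the
  extra odd point simply gets colour 2. This permits rounding \<open>M\<close> half down, which the
  factor 2 in the final inequality requires when \<open>M\<close> is odd.\<close>

lemma mono_bound_half:
  assumes "odd a" "odd b" "odd c" "even d" and "zero_sum_bound (lin_eq a b c d) M"
  shows "mono_bound (lin_eq a b c (d div 2)) 2 (M div 2)"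
  unfolding mono_bound_def
proof (intro allI impI)
  fix n \<chi> assume n: "M div 2 \<le> n" and col: "is_coloring 2 n \<chi>"
  \<comment> \<open>Equality occurs for odd \<open>M\<close> and \<open>n = M div 2\<close>.\<close>
  have "M \<le> 2 * n + 1" using n by linarith
  then have "has_zero_sum_solution (lin_eq a b c d) (2 * n + 1) (lift_coloring \<chi>)"
    using assms(5) is_coloring_lift[OF col] unfolding zero_sum_bound_def by blast
  then show "has_mono_solution (lin_eq a b c (d div 2)) n \<chi>"
    using mono_solution_of_zero_sum_lift[OF assms(1-4) col] by blast
qed

theorem theorem2:
  fixes a b c d :: int
  assumes "odd a" and "odd b" and "odd c" and "even d"
    and "mono_R_exists (lin_eq a b c (d div 2)) 2"
    and "zero_sum_R_exists (lin_eq a b c d)"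
  shows "2 * mono_R (lin_eq a b c (d div 2)) 2 \<le> zero_sum_R (lin_eq a b c d)"
proof -
  have "zero_sum_bound (lin_eq a b c d) (zero_sum_R (lin_eq a b c d))"
    using assms(6) unfolding zero_sum_R_exists_def zero_sum_R_def by (rule LeastI_ex)
  then have "mono_R (lin_eq a b c (d div 2)) 2 \<le> zero_sum_R (lin_eq a b c d) div 2"
    unfolding mono_R_def[of "lin_eq a b c (d div 2)"]
    by (intro Least_le mono_bound_half assms(1-4))
  \<comment> \<open>Doubling a floored half never exceeds the original number.\<close>
  then show ?thesis by linarith
qed

end
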